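(* Let $M$ be an exponential Young-Orlicz function, and let the measurable function $f:X\to\mathbb{R}$ belong to the exponential Orlicz space $L(M)$. Then $f$ is trigonometric approximated in $L(M)$, i.e. $\lim_{n\to\infty}E_n[f]L(M)=0$, if and only if $f\in G^o\psi_M$, or equally $$\lim_{p\to\infty}\frac{|f|_p}{\psi_M(p)}=0 .$$
   Context: $X=[0,2\pi]$ carries the normalized Lebesgue measure $d\mu=dx/(2\pi)$; $|f|_p=\left(\int_X|f|^p\,d\mu\right)^{1/p}$. A Young-Orlicz function $N:\mathbb{R}\to[0,\infty)$ is even, continuous, convex, with $N(0)=0$, strictly increasing on $[0,\infty)$, $N(u)/u\to\infty$ as $u\to\infty$, and comparable to $u^2$ (up to positive constant factors) on $[-1,1]$. $L(N)$ is the Orlicz space over $(X,\mu)$ with the Luxemburg norm $\|f\|L(N)=\inf\{k>0:\int_X N(f/k)\,d\mu\le1\}$. For a Young-Orlicz function $M$ put $\theta_M(z)=\ln M(e^z)$, $z\ge1$; its Young-Fenchel transform is $\theta_M^*(p)=\sup_{z\ge1}(pz-\theta_M(z))$, and $\psi_M(p)=\exp\left(\theta_M^*(p)/p\right)$ for $p\ge1$. $M$ is called exponential if $\theta_M$ is continuous and convex and $\psi_M(p)<\infty$ for all $p\in[1,\infty)$ (then $\psi_M(p)\to\infty$ as $p\to\infty$). It is part of the setting that for an exponential $M$ the space $L(M)$ coincides with $G\psi_M$ up to norm equivalence: there are constants $0<c\le C<\infty$ with $c\|f\|L(M)\le\|f\|G\psi_M\le C\|f\|L(M)$ for all measurable $f$.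 Here $G\psi_M$ is the Grand Lebesgue Space of measurable $f$ with $\|f\|G\psi_M=\sup_{p\in[1,\infty)}|f|_p/\psi_M(p)<\infty$, and $G^o\psi_M$ is the subspace of those $f\in G\psi_M$ with $\lim_{p\to\infty}|f|_p/\psi_M(p)=0$. $T(n)$ is the set of real trigonometric polynomials of degree at most $n$, and $E_n[f]L(M)=\inf_{g\in T(n)}\|f-g\|L(M)$. *)

theory Defs
  imports "HOL-Analysis.Analysis"
begin

text \<open>Norms take values in \<^typ>\<open>ennreal\<close> and are defined for every function, with value
  \<open>\<infinity>\<close> outside the respective space; functions are not identified almost everywhere.\<close>

definition circle_measure :: "real measure" where
  "circle_measure = scale_measure (ennreal (1 / (2 * pi))) (lebesgue_on {0..2 * pi})"

definition lp_norm :: "real \<Rightarrow> (real \<Rightarrow> real) \<Rightarrow> ennreal" where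
  "lp_norm p f =
     (let I = (\<integral>\<^sup>+ x. ennreal (\<bar>f x\<bar> powr p) \<partial>circle_measure)
      in if I = \<infinity> then \<infinity> else ennreal (enn2real I powr (1 / p)))"

definition young_orlicz :: "(real \<Rightarrow> real) \<Rightarrow> bool" where
  "young_orlicz N \<longleftrightarrow>
     (\<forall>u. 0 \<le> N u) \<and> (\<forall>u. N (- u) = N u) \<and>
     continuous_on UNIV N \<and> convex_on UNIV N \<and>
     N 0 = 0 \<and> strict_mono_on {0..} N \<and>
     filterlim (\<lambda>u. N u / u) at_top at_top \<and>
     (\<exists>c C. 0 < c \<and> 0 < C \<and> (\<forall>u\<in>{-1..1}. c * u\<^sup>2 \<le> N u \<and> N u \<le> C * u\<^sup>2))"

definition luxemburg_norm :: "(real \<Rightarrow> real) \<Rightarrow> (real \<Rightarrow> real) \<Rightarrow> ennreal" where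
  "luxemburg_norm N f =
     (INF k\<in>{k. 0 < k \<and> (\<integral>\<^sup>+ x. ennreal (N (f x / k)) \<partial>circle_measure) \<le> 1}. ennreal k)"

definition orlicz_space :: "(real \<Rightarrow> real) \<Rightarrow> (real \<Rightarrow> real) set" where
  "orlicz_space N = {f \<in> borel_measurable circle_measure. luxemburg_norm N f < \<infinity>}"

definition orlicz_theta :: "(real \<Rightarrow> real) \<Rightarrow> real \<Rightarrow> real" where
  "orlicz_theta M z = ln (M (exp z))"

text \<open>The Young-Fenchel transform is taken over \<open>z \<ge> 1\<close> only.\<close>

definition young_fenchel :: "(real \<Rightarrow> real) \<Rightarrow> real \<Rightarrow> ereal" where
  "young_fenchel \<theta> p = (SUP z\<in>{1..}. ereal (p * z - \<theta> z))"

text \<open>The transform is never \<open>-\<infinity>\<close>, so the second branch deals with a real number.\<close>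

definition orlicz_psi :: "(real \<Rightarrow> real) \<Rightarrow> real \<Rightarrow> ennreal" where
  "orlicz_psi M p =
     (let t = young_fenchel (orlicz_theta M) p
      in if t = \<infinity> then \<infinity> else ennreal (exp (real_of_ereal t / p)))"

definition exponential_young_orlicz :: "(real \<Rightarrow> real) \<Rightarrow> bool" where
  "exponential_young_orlicz M \<longleftrightarrow>
     young_orlicz M \<and>
     continuous_on {1..} (orlicz_theta M) \<and> convex_on {1..} (orlicz_theta M) \<and>
     (\<forall>p\<ge>1. orlicz_psi M p < \<infinity>)"

definition grand_norm :: "(real \<Rightarrow> ennreal) \<Rightarrow> (real \<Rightarrow> real) \<Rightarrow> ennreal" where
  "grand_norm \<psi> f = (SUP p\<in>{1..}. lp_norm p f / \<psi> p)"

definition grand_space :: "(real \<Rightarrow> ennreal) \<Rightarrow> (real \<Rightarrow> real) set" where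
  "grand_space \<psi> = {f \<in> borel_measurable circle_measure. grand_norm \<psi> f < \<infinity>}"

definition grand_space_o :: "(real \<Rightarrow> ennreal) \<Rightarrow> (real \<Rightarrow> real) set" where
  "grand_space_o \<psi> = {f \<in> grand_space \<psi>. ((\<lambda>p. lp_norm p f / \<psi> p) \<longlongrightarrow> 0) at_top}"

definition trig_polys :: "nat \<Rightarrow> (real \<Rightarrow> real) set" where
  "trig_polys n =
     {g. \<exists>a b :: nat \<Rightarrow> real.
           g = (\<lambda>x. \<Sum>k\<le>n. a k * cos (real k * x) + b k * sin (real k * x))}"

definition best_approx :: "(real \<Rightarrow> real) \<Rightarrow> nat \<Rightarrow> (real \<Rightarrow> real) \<Rightarrow> ennreal" where
  "best_approx N n f = (INF g\<in>trig_polys n. luxemburg_norm N (\<lambda>x. f x - g x))"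

text \<open>The equality of the Orlicz space \<open>L(M)\<close> with \<open>G\<psi>\<^sub>M\<close> up to equivalence of norms.
  Infinite values are allowed, so the two norms are finite for the same functions.\<close>

definition orlicz_grand_equivalent :: "(real \<Rightarrow> real) \<Rightarrow> bool" where
  "orlicz_grand_equivalent M \<longleftrightarrow>
     (\<exists>c C :: real. 0 < c \<and> c \<le> C \<and>
        (\<forall>f\<in>borel_measurable circle_measure.
           ennreal c * luxemburg_norm M f \<le> grand_norm (orlicz_psi M) f \<and>
           grand_norm (orlicz_psi M) f \<le> ennreal C * luxemburg_norm M f))"

end

theory Submission
  imports Defs
begin

text \<open>Write \<open>\<psi>\<close> for \<open>\<psi>\<^sub>M\<close>. By the norm equivalence one may work in the Grand Lebesgue norm, and
  \<open>\<psi>(p) \<rightarrow> \<infinity>\<close>. Hence \<open>|g|\<^sub>p / \<psi>(p) \<rightarrow> 0\<close> for every bounded \<open>g\<close>, in particular for trigonometric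
  polynomials, and this property passes to limits in the Grand Lebesgue norm. Conversely,
  dominated convergence holds in that norm as soon as the dominating function \<open>g\<close> satisfies
  \<open>|g|\<^sub>p / \<psi>(p) \<rightarrow> 0\<close>. Applied with \<open>g = f\<close> it approximates \<open>f\<close> by its truncations; applied with a
  constant \<open>g\<close> it approximates a truncation by continuous functions vanishing at the end points,
  and these are uniform limits of trigonometric polynomials by Stone-Weierstrass on the unit
  circle.\<close>

section \<open>The normalized measure on the circle\<close>

lemma space_circle_measure: "space circle_measure = {0..2 * pi}"
  by (simp add: circle_measure_def space_scale_measure)

lemma borel_measurable_circle_measure:
  "borel_measurable circle_measure = borel_measurable (lebesgue_on {0..2 * pi})"
  by (intro measurable_cong_sets) (simp_all add: circle_measure_def)

lemma emeasure_space_circle_measure: "emeasure circle_measure (space circle_measure) = 1"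
  by (simp add: space_circle_measure) (simp add: circle_measure_def emeasure_restrict_space 
      ennreal_mult[symmetric])

lemma AE_circle_measureI:
  assumes "negligible N" and "\<And>x. x \<in> {0..2 * pi} - N \<Longrightarrow> P x"
  shows "AE x in circle_measure. P x"
proof (rule AE_I')
  have "{0..2 * pi} \<inter> N \<in> null_sets (lebesgue_on {0..2 * pi})"
    using assms(1) by (auto simp: null_sets_restrict_space negligible_iff_null_sets null_set_Int1 null_set_Int2)
  then show "{0..2 * pi} \<inter> N \<in> null_sets circle_measure"
    by (simp add: null_sets_def circle_measure_def)
  show "{x \<in> space circle_measure. \<not> P x} \<subseteq> {0..2 * pi} \<inter> N"
    using assms(2) by (auto simp: space_circle_measure)
qed

section \<open>\<open>L_p\<close> norms: monotonicity, Minkowski inequality, dominated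
  convergence\<close>

text \<open>Removes the root, so that norm estimates become estimates of integrals. An infinite
  integral makes both sides false.\<close>

lemma lp_norm_le_iff:
  assumes "p > 0" and "r \<ge> 0"
  shows "lp_norm p f \<le> ennreal r \<longleftrightarrow>
         (\<integral>\<^sup>+ x. ennreal (\<bar>f x\<bar> powr p) \<partial>circle_measure) \<le> ennreal (r powr p)"
proof (cases "\<integral>\<^sup>+ x. ennreal (\<bar>f x\<bar> powr p) \<partial>circle_measure")
  case (real I)
  have "I powr (1 / p) \<le> r \<longleftrightarrow> I \<le> r powr p"
  proof
    assume "I powr (1 / p) \<le> r"
    then have "(I powr (1 / p)) powr p \<le> r powr p"
      using assms by (intro powr_mono2) auto
    then show "I \<le> r powr p"
      using assms real by (simp add: powr_powr)
  next
    assume "I \<le> r powr p"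
    then have "I powr (1 / p) \<le> (r powr p) powr (1 / p)"
      using assms real by (intro powr_mono2) auto
    then show "I powr (1 / p) \<le> r"
      using assms by (simp add: powr_powr)
  qed
  then show ?thesis
    using real assms by (simp add: lp_norm_def)
next
  case top
  then show ?thesis by (simp add: lp_norm_def neq_top_trans top_unique)
qed

lemma lp_norm_mono:
  assumes "p \<ge> 0" and "AE x in circle_measure. \<bar>f x\<bar> \<le> \<bar>g x\<bar>"
  shows "lp_norm p f \<le> lp_norm p g"
proof -
  have *: "(\<integral>\<^sup>+ x. ennreal (\<bar>f x\<bar> powr p) \<partial>circle_measure) \<le>
      (\<integral>\<^sup>+ x. ennreal (\<bar>g x\<bar> powr p) \<partial>circle_measure)"
    using assms by (intro nn_integral_mono_AE) (auto intro!: powr_mono2 elim!: eventually_mono)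
  show ?thesis
    using * assms(1)
    by (auto simp: lp_norm_def Let_def top_unique less_top intro!: powr_mono2 ennreal_leI enn2real_mono)
qed

lemma lp_norm_const:
  assumes "p > 0"
  shows "lp_norm p (\<lambda>x. c) = ennreal \<bar>c\<bar>"
  using assms by (simp add: lp_norm_def emeasure_space_circle_measure powr_powr)

text \<open>Weighted arithmetic-geometric mean inequality for the numbers
  \<open>(t / \<delta>) powr q\<close> and \<open>1\<close> with weights \<open>p / q\<close> and
  \<open>1 - p / q\<close>. Being affine in \<open>t powr q\<close>, the bound can be integrated to
  compare the two exponents.\<close>

lemma powr_le_weighted:
  fixes t \<delta> p q :: real
  assumes "0 < p" "p \<le> q" "0 < \<delta>" "0 \<le> t"
  shows "t powr p \<le> \<delta> powr p * (1 - p / q + p / q * (t powr q / \<delta> powr q))"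
proof (cases "t = 0")
  case False
  have "(t powr q / \<delta> powr q) powr (p / q) * 1 powr (1 - p / q)
      \<le> p / q * (t powr q / \<delta> powr q) + (1 - p / q) * 1"
    using assms False by (intro Youngs_inequality_0) auto
  moreover have "(t powr q / \<delta> powr q) powr (p / q) = t powr p / \<delta> powr p"
    using assms by (simp add: powr_divide powr_powr)
  ultimately show ?thesis
    using assms by (simp add: field_simps)
qed (use assms in auto)

text \<open>Rests on total mass one: the pointwise bound integrates to a convex combination of two
  quantities of size at most \<open>\<delta> powr p\<close>.\<close>

lemma lp_norm_mono_exponent:
  assumes "f \<in> borel_measurable circle_measure" and "0 < p" and "p \<le> q"
  shows "lp_norm p f \<le> lp_norm q f"
proof (rule ennreal_le_epsilon)
  fix e :: real
  assume fin: "lp_norm q f < top" and "e > 0"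
  \<comment> \<open>The added \<open>e\<close> keeps \<open>\<delta>\<close> positive even if the
    norm vanishes, so that division by \<open>\<delta> powr q\<close> is legitimate.\<close>
  define \<delta> where "\<delta> = enn2real (lp_norm q f) + e"
  have \<delta>: "\<delta> > 0" "lp_norm q f + ennreal e = ennreal \<delta>"
    using fin \<open>e > 0\<close> by (auto simp: \<delta>_def add_nonneg_pos)
  have "lp_norm q f \<le> ennreal \<delta>"
    using \<delta>(2) by (metis le_iff_add)
  then have int: "(\<integral>\<^sup>+ x. ennreal (\<bar>f x\<bar> powr q) \<partial>circle_measure) \<le> ennreal (\<delta> powr q)"
    using assms \<delta> by (subst (asm) lp_norm_le_iff) auto
  have "(\<integral>\<^sup>+ x. ennreal (\<bar>f x\<bar> powr p) \<partial>circle_measure) \<le>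
      (\<integral>\<^sup>+ x. ennreal (\<delta> powr p * (1 - p / q)) +
        ennreal (\<delta> powr p * (p / q) / \<delta> powr q) * ennreal (\<bar>f x\<bar> powr q) \<partial>circle_measure)"
  proof (rule nn_integral_mono)
    fix x
    have "ennreal (\<bar>f x\<bar> powr p) \<le>
       ennreal (\<delta> powr p * (1 - p / q) + \<delta> powr p * (p / q) / \<delta> powr q * \<bar>f x\<bar> powr q)"
      using powr_le_weighted[of p q \<delta> "\<bar>f x\<bar>"] assms \<delta> by (intro ennreal_leI) (simp add: field_simps)
    also have "\<dots> = ennreal (\<delta> powr p * (1 - p / q)) +
        ennreal (\<delta> powr p * (p / q) / \<delta> powr q) * ennreal (\<bar>f x\<bar> powr q)"
      using assms by (subst ennreal_plus) (auto simp: ennreal_mult''[symmetric])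
    finally show "ennreal (\<bar>f x\<bar> powr p) \<le> \<dots>" .
  qed
  also have "\<dots> = ennreal (\<delta> powr p * (1 - p / q)) + ennreal (\<delta> powr p * (p / q) / \<delta> powr q) *
      (\<integral>\<^sup>+ x. ennreal (\<bar>f x\<bar> powr q) \<partial>circle_measure)"
    using assms(1) by (subst nn_integral_add; (subst nn_integral_cmult)?)
      (auto simp: emeasure_space_circle_measure)
  also have "\<dots> \<le> ennreal (\<delta> powr p * (1 - p / q)) +
      ennreal (\<delta> powr p * (p / q) / \<delta> powr q) * ennreal (\<delta> powr q)"
    using int by (intro add_left_mono mult_left_mono) auto
  also have "\<dots> = ennreal (\<delta> powr p)"
    using assms \<delta>
    by (simp add: ennreal_mult''[symmetric] ennreal_plus[symmetric] del: ennreal_plus)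
      (simp add: right_diff_distrib)
  finally show "lp_norm p f \<le> lp_norm q f + ennreal e"
    using assms \<delta> by (simp add: lp_norm_le_iff)
qed

text \<open>Pointwise form of Minkowski's inequality: \<open>(a + b) / (r + s)\<close> is the convex
  combination of \<open>a / r\<close> and \<open>b / s\<close> with weights
  \<open>r / (r + s)\<close> and \<open>s / (r + s)\<close>, and the power function is convex. Later
  \<open>r\<close> and \<open>s\<close> are bounds for the two norms.\<close>

lemma powr_add_le_weighted:
  fixes a b r s p :: real
  assumes "p \<ge> 1" "a \<ge> 0" "b \<ge> 0" "r > 0" "s > 0"
  shows "(a + b) powr p \<le>
    (r + s) powr p * (r / (r + s) * (a powr p / r powr p) + s / (r + s) * (b powr p / s powr p))"
proof -
  \<comment> \<open>If \<open>a\<close> or \<open>b\<close> is zero, the claim reduces to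
    \<open>t powr p \<le> t\<close> for \<open>t\<close> in the unit interval; convexity serves only
    the case of two positive numbers.\<close>
  have *: "(r / (r + s)) powr p \<le> r / (r + s)" if "r > 0" "s > 0" for r s :: real
    using powr_mono'[of 1 p "r / (r + s)"] assms(1) that by simp
  have **: "y \<le> R * (c * (y / S))" if "y * (S / R) \<le> y * c" "S > 0" "R > 0" for y R S c :: real
    using that by (simp add: field_simps)
  consider "a = 0" | "b = 0" | "a > 0" "b > 0" using assms by linarith
  then show ?thesis
  proof cases
    case 1
    have "b powr p * (s / (r + s)) powr p \<le> b powr p * (s / (r + s))"
      using *[of s r] assms by (intro mult_left_mono) (auto simp: add.commute)
    then have "b powr p * (s powr p / (r + s) powr p) \<le> b powr p * (s / (r + s))"
      using assms by (simp add: powr_divide)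
    from **[OF this] show ?thesis using 1 assms by simp
  next
    case 2
    have "a powr p * (r / (r + s)) powr p \<le> a powr p * (r / (r + s))"
      using *[of r s] assms by (intro mult_left_mono) auto
    then have "a powr p * (r powr p / (r + s) powr p) \<le> a powr p * (r / (r + s))"
      using assms by (simp add: powr_divide)
    from **[OF this] show ?thesis using 2 assms by simp
  next
    case 3
    have "((1 - s / (r + s)) * (a / r) + s / (r + s) * (b / s)) powr p \<le>
       (1 - s / (r + s)) * (a / r) powr p + s / (r + s) * (b / s) powr p"
      using 3 assms convex_onD[OF powr_convex[of p], of "s / (r + s)" "a / r" "b / s"] by simp
    moreover have eq: "1 - s / (r + s) = r / (r + s)"
      using assms by (simp add: field_simps)
    moreover have "r / (r + s) * (a / r) + s / (r + s) * (b / s) = (a + b) / (r + s)"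
      using assms by (simp add: add_divide_distrib)
    ultimately have "((a + b) / (r + s)) powr p \<le>
       r / (r + s) * (a / r) powr p + s / (r + s) * (b / s) powr p"
      by simp
    then show ?thesis
      using 3 assms by (simp add: powr_divide pos_divide_le_eq mult.commute)
  qed
qed

lemma lp_norm_add:
  assumes [measurable]: "f \<in> borel_measurable circle_measure" "g \<in> borel_measurable circle_measure"
    and "p \<ge> 1"
  shows "lp_norm p (\<lambda>x. f x + g x) \<le> lp_norm p f + lp_norm p g"
proof (rule ennreal_le_epsilon)
  fix e :: real
  assume "lp_norm p f + lp_norm p g < top" and "e > 0"
  then have fin: "lp_norm p f < top" "lp_norm p g < top" by auto
  \<comment> \<open>Each norm is enlarged by \<open>e / 2\<close>, which makes \<open>r\<close> and
    \<open>s\<close> positive at a total cost of \<open>e\<close>.\<close>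
  define r where "r = enn2real (lp_norm p f) + e / 2"
  define s where "s = enn2real (lp_norm p g) + e / 2"
  have r: "r > 0" "lp_norm p f + ennreal (e / 2) = ennreal r"
    using fin \<open>e > 0\<close> by (auto simp: r_def add_nonneg_pos)
  have s: "s > 0" "lp_norm p g + ennreal (e / 2) = ennreal s"
    using fin \<open>e > 0\<close> by (auto simp: s_def add_nonneg_pos)
  have "lp_norm p f \<le> ennreal r" "lp_norm p g \<le> ennreal s"
    using r(2) s(2) by (metis le_iff_add)+
  then have int: "(\<integral>\<^sup>+ x. ennreal (\<bar>f x\<bar> powr p) \<partial>circle_measure) \<le> ennreal (r powr p)"
      "(\<integral>\<^sup>+ x. ennreal (\<bar>g x\<bar> powr p) \<partial>circle_measure) \<le> ennreal (s powr p)"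
    using assms r s by (auto simp: lp_norm_le_iff)
  define A where "A = (r + s) powr p * (r / (r + s)) / r powr p"
  define B where "B = (r + s) powr p * (s / (r + s)) / s powr p"
  have AB: "A \<ge> 0" "B \<ge> 0" using r s by (auto simp: A_def B_def)
  have "(\<integral>\<^sup>+ x. ennreal (\<bar>f x + g x\<bar> powr p) \<partial>circle_measure) \<le>
      (\<integral>\<^sup>+ x. ennreal A * ennreal (\<bar>f x\<bar> powr p) + ennreal B * ennreal (\<bar>g x\<bar> powr p) \<partial>circle_measure)"
  proof (rule nn_integral_mono)
    fix x
    have "\<bar>f x + g x\<bar> powr p \<le> (\<bar>f x\<bar> + \<bar>g x\<bar>) powr p"
      using assms by (intro powr_mono2) auto
    also have "\<dots> \<le> A * \<bar>f x\<bar> powr p + B * \<bar>g x\<bar> powr p"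
      using powr_add_le_weighted[of p "\<bar>f x\<bar>" "\<bar>g x\<bar>" r s] assms r s
      by (simp add: A_def B_def distrib_left)
    finally show "ennreal (\<bar>f x + g x\<bar> powr p) \<le>
        ennreal A * ennreal (\<bar>f x\<bar> powr p) + ennreal B * ennreal (\<bar>g x\<bar> powr p)"
      using AB by (simp add: ennreal_mult[symmetric] ennreal_plus[symmetric] ennreal_leI del: ennreal_plus)
  qed
  also have "\<dots> = ennreal A * (\<integral>\<^sup>+ x. ennreal (\<bar>f x\<bar> powr p) \<partial>circle_measure) +
      ennreal B * (\<integral>\<^sup>+ x. ennreal (\<bar>g x\<bar> powr p) \<partial>circle_measure)"
    by (simp add: nn_integral_add nn_integral_cmult)
  also have "\<dots> \<le> ennreal A * ennreal (r powr p) + ennreal B * ennreal (s powr p)"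
    using int by (intro add_mono mult_left_mono) auto
  also have "\<dots> = ennreal (A * r powr p + B * s powr p)"
    using AB by (simp add: ennreal_mult)
  also have "A * r powr p + B * s powr p = (r + s) powr p"
    using r s by (simp add: A_def B_def distrib_left[symmetric] add_divide_distrib[symmetric])
  finally have "lp_norm p (\<lambda>x. f x + g x) \<le> ennreal (r + s)"
    using assms r s by (subst lp_norm_le_iff) auto
  also have "ennreal (r + s) = lp_norm p f + ennreal (e / 2) + (lp_norm p g + ennreal (e / 2))"
    using r s by simp
  also have "\<dots> = lp_norm p f + lp_norm p g + (ennreal (e / 2) + ennreal (e / 2))"
    by (simp add: ac_simps)
  also have "ennreal (e / 2) + ennreal (e / 2) = ennreal e"
    using \<open>e > 0\<close> by (simp add: ennreal_plus[symmetric] del: ennreal_plus)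
  finally show "lp_norm p (\<lambda>x. f x + g x) \<le> lp_norm p f + lp_norm p g + ennreal e" .
qed

lemma lp_norm_tendsto_0_dominated:
  assumes [measurable]: "\<And>n. h n \<in> borel_measurable circle_measure" "g \<in> borel_measurable circle_measure"
    and p: "p > 0" and fin: "lp_norm p g < \<infinity>"
    and bound: "\<And>n. AE x in circle_measure. \<bar>h n x\<bar> \<le> \<bar>g x\<bar>"
    and lim: "AE x in circle_measure. (\<lambda>n. h n x) \<longlonglongrightarrow> 0"
  shows "(\<lambda>n. lp_norm p (h n)) \<longlonglongrightarrow> 0"
proof (rule tendsto_zero_ennreal)
  fix r :: real assume "r > 0"
  have "(\<lambda>n. \<integral>\<^sup>+ x. ennreal (\<bar>h n x\<bar> powr p) \<partial>circle_measure) \<longlonglongrightarrow>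
      (\<integral>\<^sup>+ x. 0 \<partial>circle_measure)"
  proof (rule nn_integral_dominated_convergence[where w = "\<lambda>x. ennreal (\<bar>g x\<bar> powr p)"])
    show "AE x in circle_measure. ennreal (\<bar>h n x\<bar> powr p) \<le> ennreal (\<bar>g x\<bar> powr p)" for n
      using bound[of n] p by (auto intro!: ennreal_leI powr_mono2 elim!: eventually_mono)
    show "(\<integral>\<^sup>+ x. ennreal (\<bar>g x\<bar> powr p) \<partial>circle_measure) < \<infinity>"
      using fin by (auto simp: lp_norm_def Let_def less_top split: if_splits)
    show "AE x in circle_measure. (\<lambda>n. ennreal (\<bar>h n x\<bar> powr p)) \<longlonglongrightarrow> 0"
      using lim
    proof eventually_elim
      case (elim x)
      have "(\<lambda>n. \<bar>h n x\<bar> powr p) \<longlonglongrightarrow> 0 powr p"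
        using elim p by (intro tendsto_powr' tendsto_rabs_zero) auto
      then show ?case by (simp add: ennreal_tendsto_0_iff)
    qed
  qed auto
  \<comment> \<open>The threshold belongs to \<open>r / 2\<close>: the passage from integral to norm
    gives a non-strict bound, and halving restores strictness.\<close>
  then have "\<forall>\<^sub>F n in sequentially. (\<integral>\<^sup>+ x. ennreal (\<bar>h n x\<bar> powr p) \<partial>circle_measure) < ennreal ((r / 2) powr p)"
    using \<open>r > 0\<close> by (auto dest!: order_tendstoD(2)[where a = "ennreal ((r / 2) powr p)"])
  then show "\<forall>\<^sub>F n in sequentially. lp_norm p (h n) < ennreal r"
  proof eventually_elim
    case (elim n)
    then have "lp_norm p (h n) \<le> ennreal (r / 2)"
      using p \<open>r > 0\<close> by (simp add: lp_norm_le_iff)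
    also have "\<dots> < ennreal r" using \<open>r > 0\<close> by (simp add: ennreal_less_iff)
    finally show ?case .
  qed
qed

section \<open>The Grand Lebesgue norm and dominated convergence in it\<close>

lemma grand_norm_le_iff: "grand_norm \<psi> f \<le> c \<longleftrightarrow> (\<forall>p\<ge>1. lp_norm p f / \<psi> p \<le> c)"
  by (auto simp: grand_norm_def SUP_le_iff)

lemma grand_norm_add:
  assumes "f \<in> borel_measurable circle_measure" "g \<in> borel_measurable circle_measure"
  shows "grand_norm \<psi> (\<lambda>x. f x + g x) \<le> grand_norm \<psi> f + grand_norm \<psi> g"
  unfolding grand_norm_le_iff
proof safe
  fix p :: real assume p: "p \<ge> 1"
  have "lp_norm p (\<lambda>x. f x + g x) / \<psi> p \<le> (lp_norm p f + lp_norm p g) / \<psi> p"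
    using assms p by (intro divide_right_mono_ennreal lp_norm_add)
  also have "\<dots> = lp_norm p f / \<psi> p + lp_norm p g / \<psi> p"
    by (rule add_divide_distrib_ennreal)
  also have "\<dots> \<le> grand_norm \<psi> f + grand_norm \<psi> g"
    using p by (intro add_mono) (auto simp: grand_norm_def intro: SUP_upper)
  finally show "lp_norm p (\<lambda>x. f x + g x) / \<psi> p \<le> grand_norm \<psi> f + grand_norm \<psi> g" .
qed

lemma divide_le_ennreal:
  assumes "x \<le> ennreal r" "ennreal m \<le> y" "m > 0" "r \<ge> 0"
  shows "x / y \<le> ennreal (r / m)"
proof (rule divide_le_posI_ennreal)
  show "y > 0"
    using assms by (metis ennreal_less_zero_iff less_le_trans)
  have "ennreal r = ennreal m * ennreal (r / m)"
    using assms by (simp add: ennreal_mult[symmetric])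
  also have "\<dots> \<le> y * ennreal (r / m)"
    using assms by (intro mult_right_mono) auto
  finally show "x \<le> y * ennreal (r / m)"
    using assms by order
qed

lemma grand_norm_le_bounded:
  assumes "\<And>p. p \<ge> 1 \<Longrightarrow> ennreal m \<le> \<psi> p" "m > 0"
    and "AE x in circle_measure. \<bar>f x\<bar> \<le> c" "c \<ge> 0"
  shows "grand_norm \<psi> f \<le> ennreal (c / m)"
  unfolding grand_norm_le_iff
proof safe
  fix p :: real assume p: "p \<ge> 1"
  have "lp_norm p f \<le> lp_norm p (\<lambda>x. c)"
    using assms p by (intro lp_norm_mono) auto
  also have "\<dots> = ennreal c" using assms p by (simp add: lp_norm_const)
  finally show "lp_norm p f / \<psi> p \<le> ennreal (c / m)"
    using assms p by (intro divide_le_ennreal) auto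
qed

text \<open>Large exponents are controlled by the dominating function uniformly in \<open>n\<close>; below a fixed
  exponent \<open>P\<close> the \<open>L\<^sub>P\<close> norm suffices.\<close>

lemma grand_norm_tendsto_0_dominated:
  assumes meas: "\<And>n. h n \<in> borel_measurable circle_measure" "g \<in> borel_measurable circle_measure"
    and \<psi>: "\<And>p. p \<ge> 1 \<Longrightarrow> ennreal m \<le> \<psi> p" "m > 0"
    and fin: "\<And>p. p \<ge> 1 \<Longrightarrow> lp_norm p g < \<infinity>"
    and g: "((\<lambda>p. lp_norm p g / \<psi> p) \<longlongrightarrow> 0) at_top"
    and bound: "\<And>n. AE x in circle_measure. \<bar>h n x\<bar> \<le> \<bar>g x\<bar>"
    and lim: "AE x in circle_measure. (\<lambda>n. h n x) \<longlonglongrightarrow> 0"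
  shows "(\<lambda>n. grand_norm \<psi> (h n)) \<longlonglongrightarrow> 0"
proof (rule tendsto_zero_ennreal)
  fix r :: real assume r: "r > 0"
  have "\<forall>\<^sub>F p in at_top. lp_norm p g / \<psi> p < ennreal (r / 2)"
    using g r by (auto dest!: order_tendstoD(2)[where a = "ennreal (r / 2)"])
  then obtain P0 where P0: "\<And>p. p \<ge> P0 \<Longrightarrow> lp_norm p g / \<psi> p < ennreal (r / 2)"
    by (auto simp: eventually_at_top_linorder)
  define P where "P = max 1 P0"
  have P: "P \<ge> 1" "\<And>p. p \<ge> P \<Longrightarrow> lp_norm p g / \<psi> p < ennreal (r / 2)"
    using P0 by (auto simp: P_def)
  have "(\<lambda>n. lp_norm P (h n)) \<longlonglongrightarrow> 0"
    using P(1) by (intro lp_norm_tendsto_0_dominated[OF meas _ fin bound lim]) auto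
  \<comment> \<open>The factor \<open>m\<close> is absorbed on dividing by
    \<open>\<psi> p \<ge> m\<close>, simultaneously for all \<open>p\<close> up to
    \<open>P\<close>.\<close>
  then have "\<forall>\<^sub>F n in sequentially. lp_norm P (h n) < ennreal (r / 2 * m)"
    using \<psi>(2) r by (auto dest!: order_tendstoD(2)[where a = "ennreal (r / 2 * m)"])
  then show "\<forall>\<^sub>F n in sequentially. grand_norm \<psi> (h n) < ennreal r"
  proof eventually_elim
    case (elim n)
    have "grand_norm \<psi> (h n) \<le> ennreal (r / 2)"
      unfolding grand_norm_le_iff
    proof safe
      fix p :: real assume p: "p \<ge> 1"
      show "lp_norm p (h n) / \<psi> p \<le> ennreal (r / 2)"
      proof (cases "p \<le> P")
        case True
        have "lp_norm p (h n) \<le> lp_norm P (h n)"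
          using True p meas by (intro lp_norm_mono_exponent) auto
        then have "lp_norm p (h n) \<le> ennreal (r / 2 * m)" using elim by order
        then have "lp_norm p (h n) / \<psi> p \<le> ennreal ((r / 2 * m) / m)"
          using \<psi> p r by (intro divide_le_ennreal) auto
        then show ?thesis using \<psi> by simp
      next
        case False
        have "lp_norm p (h n) / \<psi> p \<le> lp_norm p g / \<psi> p"
          using p bound by (intro divide_right_mono_ennreal lp_norm_mono) auto
        then show ?thesis using P(2)[of p] False by simp
      qed
    qed
    also have "\<dots> < ennreal r" using r by (simp add: ennreal_less_iff)
    finally show ?case .
  qed
qed

section \<open>Lower bounds and growth of \<open>orlicz_psi\<close>\<close>

text \<open>A single \<open>z\<close> is a competitor in the supremum defining the transform;
  dividing by \<open>p\<close> and exponentiating gives the bound. An infinite transform makes it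
  trivial.\<close>

lemma orlicz_psi_ge:
  assumes "z \<ge> 1" "p > 0"
  shows "ennreal (exp (z - orlicz_theta M z / p)) \<le> orlicz_psi M p"
proof -
  let ?t = "young_fenchel (orlicz_theta M) p"
  have le: "ereal (p * z - orlicz_theta M z) \<le> ?t"
    unfolding young_fenchel_def using assms(1) by (intro SUP_upper) auto
  show ?thesis
  proof (cases ?t)
    case (real t)
    then have "z - orlicz_theta M z / p \<le> t / p"
      using divide_right_mono[of "p * z - orlicz_theta M z" t p] le assms(2)
      by (simp add: diff_divide_distrib)
    then show ?thesis using real by (simp add: orlicz_psi_def)
  qed (use le in \<open>auto simp: orlicz_psi_def\<close>)
qed

text \<open>The choice \<open>z = 1\<close> bounds \<open>orlicz_psi\<close> away from zero
  uniformly in \<open>p\<close>, so that sup-norm estimates carry over to the Grand Lebesgue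
  norm.\<close>

lemma orlicz_psi_ge_pos:
  assumes "p \<ge> 1"
  shows "ennreal (exp (1 - \<bar>orlicz_theta M 1\<bar>)) \<le> orlicz_psi M p"
proof -
  have "\<bar>orlicz_theta M 1\<bar> / p \<le> \<bar>orlicz_theta M 1\<bar> / 1"
    using assms by (intro divide_left_mono) auto
  moreover have "orlicz_theta M 1 / p \<le> \<bar>orlicz_theta M 1\<bar> / p"
    using assms by (intro divide_right_mono) auto
  ultimately have "exp (1 - \<bar>orlicz_theta M 1\<bar>) \<le> exp (1 - orlicz_theta M 1 / p)"
    by simp
  then show ?thesis
    using orlicz_psi_ge[of 1 p M] assms by (meson ennreal_leI order_refl order_trans less_le_trans zero_less_one)
qed

text \<open>For fixed \<open>z\<close> the lower bound \<open>exp (z - orlicz_theta M z / p)\<close>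
  tends to \<open>exp z\<close>, and \<open>z\<close> may be arbitrarily large.\<close>

lemma orlicz_psi_at_top: "(orlicz_psi M \<longlongrightarrow> \<infinity>) at_top"
proof (rule order_tendstoI)
  fix a :: ennreal assume "a < \<infinity>"
  then obtain b where b: "a = ennreal b" "b \<ge> 0" by (cases a) auto
  \<comment> \<open>The summand \<open>1\<close> pays for \<open>orlicz_theta M z / p < 1\<close>,
    leaving \<open>exp (ln (b + 1)) > b\<close>. The maximum keeps \<open>z\<close> in the range of
    the supremum.\<close>
  define z where "z = max 1 (ln (b + 1) + 1)"
  have "((\<lambda>p. orlicz_theta M z / p) \<longlongrightarrow> 0) at_top"
    by (intro tendsto_divide_0[OF tendsto_const] filterlim_at_top_imp_at_infinity filterlim_ident)
  then have "\<forall>\<^sub>F p in at_top. orlicz_theta M z / p < 1"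
    by (rule order_tendstoD) auto
  then show "\<forall>\<^sub>F p in at_top. a < orlicz_psi M p"
    using eventually_gt_at_top[of "0::real"]
  proof eventually_elim
    case (elim p)
    have "b < exp (ln (b + 1))" using b by simp
    also have "\<dots> \<le> exp (z - orlicz_theta M z / p)"
      using elim(1) by (auto simp: z_def max_def)
    finally have "a < ennreal (exp (z - orlicz_theta M z / p))"
      using b by (simp add: ennreal_less_iff)
    also have "\<dots> \<le> orlicz_psi M p"
      using elim by (intro orlicz_psi_ge) (auto simp: z_def)
    finally show ?case .
  qed
qed auto

lemma lp_norm_bounded_div_orlicz_psi:
  assumes "AE x in circle_measure. \<bar>f x\<bar> \<le> c"
  shows "((\<lambda>p. lp_norm p f / orlicz_psi M p) \<longlongrightarrow> 0) at_top"
proof (rule tendsto_zero_ennreal)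
  fix r :: real assume r: "r > 0"
  \<comment> \<open>A positive bound whatever the sign of \<open>c\<close>. Once
    \<open>orlicz_psi\<close> exceeds \<open>2 * d / r\<close>, the quotient is at most
    \<open>r / 2\<close>.\<close>
  define d where "d = \<bar>c\<bar> + 1"
  have d: "d > 0" by (simp add: d_def)
  have "\<forall>\<^sub>F p in at_top. ennreal (2 * d / r) < orlicz_psi M p"
    using order_tendstoD(1)[OF orlicz_psi_at_top] by simp
  then show "\<forall>\<^sub>F p in at_top. lp_norm p f / orlicz_psi M p < ennreal r"
    using eventually_gt_at_top[of "0::real"]
  proof eventually_elim
    case (elim p)
    have "lp_norm p f \<le> lp_norm p (\<lambda>x. d)"
      using assms elim by (intro lp_norm_mono) (auto simp: d_def)
    also have "\<dots> = ennreal d" using elim by (simp add: lp_norm_const d_def)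
    finally have "lp_norm p f / orlicz_psi M p \<le> ennreal (d / (2 * d / r))"
      using elim r by (intro divide_le_ennreal) (auto simp: d_def)
    also have "\<dots> < ennreal r" using r d by (simp add: ennreal_less_iff)
    finally show ?case .
  qed
qed

section \<open>The algebra of trigonometric polynomials\<close>

lemma trig_polysI:
  fixes n :: nat and a b :: "nat \<Rightarrow> real"
  shows "(\<lambda>x. \<Sum>k\<le>n. a k * cos (real k * x) + b k * sin (real k * x)) \<in> trig_polys n"
  by (auto simp: trig_polys_def)

lemma trig_polys_mono:
  assumes "m \<le> n"
  shows "trig_polys m \<subseteq> trig_polys n"
proof
  fix g assume "g \<in> trig_polys m"
  then obtain a b where g: "g = (\<lambda>x. \<Sum>k\<le>m. a k * cos (real k * x) + b k * sin (real k * x))"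
    by (auto simp: trig_polys_def)
  \<comment> \<open>The coefficients are padded with zeros beyond degree \<open>m\<close>.\<close>
  let ?a = "\<lambda>k. if k \<le> m then a k else 0" and ?b = "\<lambda>k. if k \<le> m then b k else 0"
  have "(\<Sum>k\<le>n. ?a k * cos (real k * x) + ?b k * sin (real k * x)) = g x" for x
    unfolding g using assms by (intro sum.mono_neutral_cong_right) auto
  then have "g = (\<lambda>x. \<Sum>k\<le>n. ?a k * cos (real k * x) + ?b k * sin (real k * x))" by auto
  then show "g \<in> trig_polys n" using trig_polysI[of ?a ?b n] by simp
qed

lemma trig_polys_add:
  assumes "f \<in> trig_polys n" "g \<in> trig_polys n"
  shows "(\<lambda>x. f x + g x) \<in> trig_polys n"
proof -
  obtain a b where f: "f = (\<lambda>x. \<Sum>k\<le>n. a k * cos (real k * x) + b k * sin (real k * x))"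
    using assms(1) by (auto simp: trig_polys_def)
  obtain c d where g: "g = (\<lambda>x. \<Sum>k\<le>n. c k * cos (real k * x) + d k * sin (real k * x))"
    using assms(2) by (auto simp: trig_polys_def)
  have "(\<lambda>x. f x + g x) =
      (\<lambda>x. \<Sum>k\<le>n. (a k + c k) * cos (real k * x) + (b k + d k) * sin (real k * x))"
    by (simp add: f g sum.distrib algebra_simps)
  then show ?thesis using trig_polysI[of "\<lambda>k. a k + c k" "\<lambda>k. b k + d k" n] by simp
qed

lemma trig_polys_cmult:
  assumes "f \<in> trig_polys n"
  shows "(\<lambda>x. c * f x) \<in> trig_polys n"
proof -
  obtain a b where f: "f = (\<lambda>x. \<Sum>k\<le>n. a k * cos (real k * x) + b k * sin (real k * x))"
    using assms by (auto simp: trig_polys_def)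
  have "(\<lambda>x. c * f x) = (\<lambda>x. \<Sum>k\<le>n. (c * a k) * cos (real k * x) + (c * b k) * sin (real k * x))"
    by (simp add: f sum_distrib_left algebra_simps)
  then show ?thesis using trig_polysI[of "\<lambda>k. c * a k" "\<lambda>k. c * b k" n] by simp
qed

lemma trig_polys_sum:
  assumes "\<And>i. i \<in> I \<Longrightarrow> f i \<in> trig_polys n"
  shows "(\<lambda>x. \<Sum>i\<in>I. f i x) \<in> trig_polys n"
  using assms
proof (induction I rule: infinite_finite_induct)
  case (insert i I)
  then show ?case by (simp add: trig_polys_add)
qed (use trig_polysI[of "\<lambda>_. 0" "\<lambda>_. 0" n] in auto)

lemma cos_in_trig_polys:
  assumes "k \<le> n"
  shows "(\<lambda>x. cos (real k * x)) \<in> trig_polys n"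
  using trig_polysI[of "\<lambda>j. if j = k then 1 else 0" "\<lambda>_. 0" n] assms
  by (simp add: if_distrib[of "\<lambda>t. t * _"] cong: if_cong)

lemma sin_in_trig_polys:
  assumes "k \<le> n"
  shows "(\<lambda>x. sin (real k * x)) \<in> trig_polys n"
  using trig_polysI[of "\<lambda>_. 0" "\<lambda>j. if j = k then 1 else 0" n] assms
  by (simp add: if_distrib[of "\<lambda>t. t * _"] cong: if_cong)

lemma cos_int_in_trig_polys:
  assumes "\<bar>i\<bar> \<le> int n"
  shows "(\<lambda>x. cos (of_int i * x)) \<in> trig_polys n"
proof (cases "i \<ge> 0")
  case True
  then show ?thesis using cos_in_trig_polys[of "nat i" n] assms by simp
next
  case False
  then have "cos (of_int i * x) = cos (real (nat (- i)) * x)" for x :: real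
    by simp
  then show ?thesis using cos_in_trig_polys[of "nat (- i)" n] assms False by simp
qed

lemma sin_int_in_trig_polys:
  assumes "\<bar>i\<bar> \<le> int n"
  shows "(\<lambda>x. sin (of_int i * x)) \<in> trig_polys n"
proof (cases "i \<ge> 0")
  case True
  then show ?thesis using sin_in_trig_polys[of "nat i" n] assms by simp
next
  case False
  then have "sin (of_int i * x) = - 1 * sin (real (nat (- i)) * x)" for x :: real
    by simp
  then show ?thesis
    using trig_polys_cmult[OF sin_in_trig_polys[of "nat (- i)" n], of "-1"] assms False by simp
qed

text \<open>The product-to-sum formulas turn frequencies \<open>k\<close> and \<open>l\<close> into
  \<open>k - l\<close> and \<open>k + l\<close>, both of modulus at most
  \<open>m + n\<close>.\<close>

lemma trig_polys_mult:
  assumes "f \<in> trig_polys m" "g \<in> trig_polys n"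
  shows "(\<lambda>x. f x * g x) \<in> trig_polys (m + n)"
proof -
  obtain a b where f: "f = (\<lambda>x. \<Sum>k\<le>m. a k * cos (real k * x) + b k * sin (real k * x))"
    using assms(1) by (auto simp: trig_polys_def)
  obtain c d where g: "g = (\<lambda>x. \<Sum>l\<le>n. c l * cos (real l * x) + d l * sin (real l * x))"
    using assms(2) by (auto simp: trig_polys_def)
  let ?T = "\<lambda>k l x. (a k * cos (real k * x) + b k * sin (real k * x)) *
      (c l * cos (real l * x) + d l * sin (real l * x))"
  have T: "?T k l \<in> trig_polys (m + n)" if kl: "k \<le> m" "l \<le> n" for k l
  proof -
    \<comment> \<open>The difference may be negative, hence integer frequencies; the parity of
      cosine and sine brings them back to natural ones.\<close>
    let ?i = "int k - int l" and ?j = "int k + int l"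
    have "?T k l x = ((a k * c l + b k * d l) / 2 * cos (of_int ?i * x) +
        (a k * c l - b k * d l) / 2 * cos (of_int ?j * x)) +
        ((b k * c l - a k * d l) / 2 * sin (of_int ?i * x) +
        (b k * c l + a k * d l) / 2 * sin (of_int ?j * x))" for x
      by (simp add: cos_diff cos_add sin_diff sin_add left_diff_distrib distrib_right)
        (simp add: field_simps)
    then have "?T k l = (\<lambda>x. ((a k * c l + b k * d l) / 2 * cos (of_int ?i * x) +
        (a k * c l - b k * d l) / 2 * cos (of_int ?j * x)) +
        ((b k * c l - a k * d l) / 2 * sin (of_int ?i * x) +
        (b k * c l + a k * d l) / 2 * sin (of_int ?j * x)))" by blast
    also have "\<dots> \<in> trig_polys (m + n)"
      using kl by (intro trig_polys_add trig_polys_cmult cos_int_in_trig_polys sin_int_in_trig_polys) auto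
    finally show ?thesis .
  qed
  have "(\<lambda>x. f x * g x) = (\<lambda>x. \<Sum>k\<le>m. \<Sum>l\<le>n. ?T k l x)"
    by (simp add: f g sum_product)
  also have "\<dots> \<in> trig_polys (m + n)"
    using T by (intro trig_polys_sum) auto
  finally show ?thesis .
qed

section \<open>Uniform approximation on the circle and continuous approximants of bounded
  functions\<close>

lemma continuous_on_trig_polys:
  assumes "g \<in> trig_polys n"
  shows "continuous_on A g"
  using assms unfolding trig_polys_def by (auto intro!: continuous_intros)

text \<open>Links Stone-Weierstrass on the circle to trigonometric polynomials. A real-linear map of
  the plane becomes \<open>f 1 * cos x + f \<i> * sin x\<close> along \<open>cis\<close>; sums and
  products are covered by the algebra structure.\<close>

lemma real_polynomial_function_cis_in_trig_polys:
  assumes "real_polynomial_function p"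
  shows "\<exists>n. (\<lambda>x. p (cis x)) \<in> trig_polys n"
  using assms
proof induction
  case (linear f)
  interpret bounded_linear f by fact
  have "f (cis x) = f 1 * cos (real 1 * x) + f \<i> * sin (real 1 * x)" for x
  proof -
    have "cis x = cos x *\<^sub>R 1 + sin x *\<^sub>R \<i>" by (simp add: complex_eq_iff)
    then show ?thesis by (simp only: add scaleR) simp
  qed
  then have "(\<lambda>x. f (cis x)) = (\<lambda>x. f 1 * cos (real 1 * x) + f \<i> * sin (real 1 * x))" by blast
  also have "\<dots> \<in> trig_polys 1"
    by (intro trig_polys_add trig_polys_cmult cos_in_trig_polys sin_in_trig_polys) auto
  finally show ?case by blast
next
  case (const c)
  have "(\<lambda>x. c * cos (real 0 * x)) \<in> trig_polys 0"
    by (intro trig_polys_cmult cos_in_trig_polys) auto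
  then show ?case by auto
next
  case (add f g)
  then obtain m n where "(\<lambda>x. f (cis x)) \<in> trig_polys m" "(\<lambda>x. g (cis x)) \<in> trig_polys n"
    by blast
  then have "(\<lambda>x. f (cis x) + g (cis x)) \<in> trig_polys (max m n)"
    by (intro trig_polys_add) (auto intro: subsetD[OF trig_polys_mono, rotated])
  then show ?case by blast
next
  case (mult f g)
  then show ?case using trig_polys_mult by blast
qed

text \<open>A continuous function with equal boundary values factors through the unit circle; the factor
  is continuous because preimages of closed sets are images of compact sets under \<^const>\<open>cis\<close>.\<close>

lemma continuous_periodic_approx_trig_polys:
  fixes c :: "real \<Rightarrow> real"
  assumes cont: "continuous_on {0..2 * pi} c" and per: "c 0 = c (2 * pi)" and "e > 0"
  obtains n g where "g \<in> trig_polys n" "\<And>x. x \<in> {0..2 * pi} \<Longrightarrow> \<bar>c x - g x\<bar> < e"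
proof -
  define H where "H z = c (Arg2pi z)" for z
  have H: "H (cis x) = c x" if "x \<in> {0..2 * pi}" for x
  proof (cases "x = 2 * pi")
    case True
    \<comment> \<open>The argument of \<open>cis (2 * pi) = 1\<close> is \<open>0\<close>, so
      \<open>H\<close> takes the value \<open>c 0\<close> there; this is where equal boundary values
      enter.\<close>
    then show ?thesis using per Arg2pi_of_real[of 1] by (simp add: H_def)
  next
    case False
    then have "Arg2pi (cis x) = x"
      using that by (intro Arg2pi_unique[of 1]) (auto simp: cis_conv_exp)
    then show ?thesis by (simp add: H_def)
  qed
  have surj: "\<exists>x\<in>{0..2 * pi}. z = cis x" if "norm z = 1" for z
    using Arg2pi[of z] that by (intro bexI[of _ "Arg2pi z"]) (auto simp: is_Arg_def cis_conv_exp)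
  have "continuous_on (sphere 0 1) H"
    unfolding continuous_on_closed_vimage[OF closed_sphere]
  proof safe
    fix B :: "real set" assume "closed B"
    have "H -` B \<inter> sphere 0 1 = cis ` ({0..2 * pi} \<inter> c -` B)"
      using H surj by auto (metis IntI atLeastAtMost_iff image_eqI vimageI)
    moreover have "compact (cis ` ({0..2 * pi} \<inter> c -` B))"
      using \<open>closed B\<close> cont
      by (intro compact_continuous_image continuous_intros)
        (auto simp: compact_eq_bounded_closed intro: continuous_closed_preimage bounded_Int)
    ultimately show "closed (H -` B \<inter> sphere 0 1)"
      by (simp add: compact_imp_closed)
  qed
  then obtain p where p: "real_polynomial_function p" "\<And>z. z \<in> sphere 0 1 \<Longrightarrow> \<bar>H z - p z\<bar> < e"
    using Stone_Weierstrass_real_polynomial_function[OF compact_sphere] \<open>e > 0\<close> by blast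
  obtain n where "(\<lambda>x. p (cis x)) \<in> trig_polys n"
    using real_polynomial_function_cis_in_trig_polys[OF p(1)] by blast
  then show ?thesis
    using that[of "\<lambda>x. p (cis x)" n] p(2) H by (metis mem_sphere_0 norm_cis)
qed

text \<open>Measurability supplies continuous functions converging almost everywhere. Clipping them
  to \<open>[-K, K]\<close> preserves the limit, since \<open>f\<close> takes values in that
  interval, and a cutoff forces them to vanish at both end points.\<close>

lemma bounded_measurable_limit_continuous_periodic:
  assumes "f \<in> borel_measurable circle_measure" and bound: "\<And>x. \<bar>f x\<bar> \<le> K"
  obtains c :: "nat \<Rightarrow> real \<Rightarrow> real" where
    "\<And>n. continuous_on UNIV (c n)" "\<And>n. c n 0 = c n (2 * pi)" "\<And>n x. \<bar>c n x\<bar> \<le> K"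
    "AE x in circle_measure. (\<lambda>n. c n x) \<longlonglongrightarrow> f x"
proof -
  have K: "K \<ge> 0" using bound[of 0] by linarith
  have "f measurable_on {0..2 * pi}"
    using assms(1) by (simp add: measurable_on_iff_borel_measurable borel_measurable_circle_measure)
  then obtain N g where N: "negligible N" and g: "\<And>n. continuous_on UNIV (g n)"
    and lim: "\<And>x. x \<notin> N \<Longrightarrow> (\<lambda>n. g n x) \<longlonglongrightarrow> (if x \<in> {0..2 * pi} then f x else 0)"
    unfolding measurable_on_def by blast
  \<comment> \<open>The cutoff \<open>1 - \<bar>cos (x / 2)\<bar> ^ n\<close> is zero at
    \<open>0\<close> and \<open>2 * pi\<close> and tends to \<open>1\<close> at every interior
    point, so it only affects a null set in the limit.\<close>
  define c where "c n x = max (- K) (min K (g n x)) * (1 - \<bar>cos (x / 2)\<bar> ^ n)" for n :: nat and x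
  show ?thesis
  proof (rule that[of c])
    show "continuous_on UNIV (c n)" for n
      unfolding c_def by (intro continuous_intros g) auto
    show "c n 0 = c n (2 * pi)" for n by (simp add: c_def)
    show "\<bar>c n x\<bar> \<le> K" for n x
    proof -
      have "\<bar>1 - \<bar>cos (x / 2)\<bar> ^ n\<bar> \<le> 1"
        by (simp add: power_le_one)
      moreover have "\<bar>max (- K) (min K (g n x))\<bar> \<le> K" using K by auto
      ultimately have "\<bar>c n x\<bar> \<le> K * 1"
        unfolding c_def abs_mult using K by (intro mult_mono) auto
      then show ?thesis by simp
    qed
    show "AE x in circle_measure. (\<lambda>n. c n x) \<longlonglongrightarrow> f x"
    proof (rule AE_circle_measureI)
      show "negligible (N \<union> {0, 2 * pi})" using N by simp
    next
      fix x assume x: "x \<in> {0..2 * pi} - (N \<union> {0, 2 * pi})"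
      have "sin (x / 2) > 0" using x by (intro sin_gt_zero) auto
      then have "(cos (x / 2))\<^sup>2 < 1"
        using sin_cos_squared_add[of "x / 2"] zero_less_power[of "sin (x / 2)" 2] by linarith
      then have "\<bar>cos (x / 2)\<bar> < 1" by (simp add: abs_square_less_1)
      then have "(\<lambda>n. \<bar>cos (x / 2)\<bar> ^ n) \<longlonglongrightarrow> 0" by (intro LIMSEQ_power_zero) simp
      moreover have "(\<lambda>n. g n x) \<longlonglongrightarrow> f x" using lim[of x] x by simp
      ultimately have "(\<lambda>n. c n x) \<longlonglongrightarrow> max (- K) (min K (f x)) * (1 - 0)"
        unfolding c_def by (intro tendsto_mult tendsto_diff tendsto_max tendsto_min tendsto_const)
      also have "max (- K) (min K (f x)) * (1 - 0) = f x" using bound[of x] by auto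
      finally show "(\<lambda>n. c n x) \<longlonglongrightarrow> f x" .
    qed
  qed
qed

section \<open>Approximability by trigonometric polynomials in the Grand Lebesgue norm\<close>

lemma borel_measurable_circle_measure_continuous:
  fixes g :: "real \<Rightarrow> real"
  assumes "continuous_on {0..2 * pi} g"
  shows "g \<in> borel_measurable circle_measure"
  using continuous_imp_measurable_on_sets_lebesgue[OF assms]
  by (simp add: borel_measurable_circle_measure)

lemma grand_norm_approx_trig_polys:
  assumes [measurable]: "f \<in> borel_measurable circle_measure"
    and fin: "\<And>p. p \<ge> 1 \<Longrightarrow> lp_norm p f < \<infinity>"
    and lim: "((\<lambda>p. lp_norm p f / orlicz_psi M p) \<longlongrightarrow> 0) at_top" and e: "e > 0"
  obtains n g where "g \<in> trig_polys n" "grand_norm (orlicz_psi M) (\<lambda>x. f x - g x) \<le> ennreal e"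
proof -
  let ?\<psi> = "orlicz_psi M"
  define m where "m = exp (1 - \<bar>orlicz_theta M 1\<bar>)"
  have m: "m > 0" "\<And>p. p \<ge> 1 \<Longrightarrow> ennreal m \<le> ?\<psi> p"
    using orlicz_psi_ge_pos by (auto simp: m_def)
  \<comment> \<open>The truncation error is dominated by \<open>\<bar>f x\<bar>\<close> and is
    exactly zero as soon as \<open>k\<close> exceeds \<open>\<bar>f x\<bar>\<close>.\<close>
  define T where "T k x = max (- real k) (min (real k) (f x))" for k x
  have [measurable]: "T k \<in> borel_measurable circle_measure" for k
    unfolding T_def by measurable
  have "(\<lambda>k. grand_norm ?\<psi> (\<lambda>x. f x - T k x)) \<longlonglongrightarrow> 0"
  proof (rule grand_norm_tendsto_0_dominated[OF _ _ m(2) m(1) fin lim])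
    have "(\<lambda>k. f x - T k x) \<longlonglongrightarrow> 0" for x
    proof (rule tendsto_eventually)
      show "\<forall>\<^sub>F k in sequentially. f x - T k x = 0"
        using eventually_ge_at_top[of "nat \<lceil>\<bar>f x\<bar>\<rceil>"]
        by eventually_elim (auto simp: T_def)
    qed
    then show "AE x in circle_measure. (\<lambda>k. f x - T k x) \<longlonglongrightarrow> 0" by simp
    show "AE x in circle_measure. \<bar>f x - T k x\<bar> \<le> \<bar>f x\<bar>" for k by (auto simp: T_def)
  qed auto
  \<comment> \<open>The error \<open>e\<close> is split into thirds: truncation, replacement by a
    continuous function, and uniform approximation by a trigonometric polynomial.\<close>
  then have "\<forall>\<^sub>F k in sequentially. grand_norm ?\<psi> (\<lambda>x. f x - T k x) < ennreal (e / 3)"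
    using e by (intro order_tendstoD(2)) auto
  then obtain k where k: "grand_norm ?\<psi> (\<lambda>x. f x - T k x) < ennreal (e / 3)"
    using eventually_happens'[OF sequentially_bot] by blast
  have Tk: "\<bar>T k x\<bar> \<le> real k" for x by (auto simp: T_def)
  obtain c :: "nat \<Rightarrow> real \<Rightarrow> real" where c: "\<And>n. continuous_on UNIV (c n)"
    "\<And>n. c n 0 = c n (2 * pi)" "\<And>n x. \<bar>c n x\<bar> \<le> real k"
    "AE x in circle_measure. (\<lambda>n. c n x) \<longlonglongrightarrow> T k x"
    using bounded_measurable_limit_continuous_periodic[of "T k" "real k"] Tk by auto
  have c_cont: "continuous_on {0..2 * pi} (c n)" for n
    using c(1) continuous_on_subset by blast
  note [measurable] = borel_measurable_circle_measure_continuous[OF c_cont]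
  have "(\<lambda>n. grand_norm ?\<psi> (\<lambda>x. T k x - c n x)) \<longlonglongrightarrow> 0"
  proof (rule grand_norm_tendsto_0_dominated[OF _ _ m(2) m(1)])
    \<comment> \<open>Both \<open>T k\<close> and \<open>c n\<close> are bounded by
      \<open>k\<close>, so the constant \<open>2 * real k\<close> dominates their
      difference.\<close>
    show "((\<lambda>p. lp_norm p (\<lambda>x. 2 * real k) / ?\<psi> p) \<longlongrightarrow> 0) at_top"
      by (rule lp_norm_bounded_div_orlicz_psi[of _ "2 * real k"]) auto
    show "lp_norm p (\<lambda>x. 2 * real k) < \<infinity>" if "p \<ge> 1" for p
      using that by (simp add: lp_norm_const)
    have "\<bar>T k x - c n x\<bar> \<le> \<bar>2 * real k\<bar>" for n x
      using Tk[of x] c(3)[of n x] by linarith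
    then show "AE x in circle_measure. \<bar>T k x - c n x\<bar> \<le> \<bar>2 * real k\<bar>" for n by blast
    show "AE x in circle_measure. (\<lambda>n. T k x - c n x) \<longlonglongrightarrow> 0"
      using c(4) by eventually_elim (auto intro: tendsto_eq_intros)
  qed auto
  then have "\<forall>\<^sub>F n in sequentially. grand_norm ?\<psi> (\<lambda>x. T k x - c n x) < ennreal (e / 3)"
    using e by (intro order_tendstoD(2)) auto
  then obtain n where n: "grand_norm ?\<psi> (\<lambda>x. T k x - c n x) < ennreal (e / 3)"
    using eventually_happens'[OF sequentially_bot] by blast
  \<comment> \<open>A uniform error below \<open>e / 3 * m\<close> becomes at most
    \<open>e / 3\<close> in the Grand Lebesgue norm, because \<open>orlicz_psi\<close> is at least
    \<open>m\<close>.\<close>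
  obtain d g where g: "g \<in> trig_polys d" "\<And>x. x \<in> {0..2 * pi} \<Longrightarrow> \<bar>c n x - g x\<bar> < e / 3 * m"
    using continuous_periodic_approx_trig_polys[OF c_cont c(2), of "e / 3 * m"] e m(1)
    by (metis divide_pos_pos mult_pos_pos zero_less_numeral)
  note [measurable] = borel_measurable_circle_measure_continuous[OF continuous_on_trig_polys[OF g(1)]]
  have "grand_norm ?\<psi> (\<lambda>x. c n x - g x) \<le> ennreal (e / 3 * m / m)"
    using g(2) e m
    by (intro grand_norm_le_bounded) (auto intro!: AE_I2 less_imp_le simp: space_circle_measure)
  then have cg: "grand_norm ?\<psi> (\<lambda>x. c n x - g x) \<le> ennreal (e / 3)" using m by simp
  have "grand_norm ?\<psi> (\<lambda>x. f x - g x) =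
      grand_norm ?\<psi> (\<lambda>x. (f x - T k x) + ((T k x - c n x) + (c n x - g x)))"
    by simp
  also have "\<dots> \<le> grand_norm ?\<psi> (\<lambda>x. f x - T k x) +
      grand_norm ?\<psi> (\<lambda>x. (T k x - c n x) + (c n x - g x))"
    by (rule grand_norm_add) measurable
  also have "\<dots> \<le> grand_norm ?\<psi> (\<lambda>x. f x - T k x) +
      (grand_norm ?\<psi> (\<lambda>x. T k x - c n x) + grand_norm ?\<psi> (\<lambda>x. c n x - g x))"
    by (intro add_left_mono grand_norm_add) measurable
  also have "\<dots> \<le> ennreal (e / 3) + (ennreal (e / 3) + ennreal (e / 3))"
    using k n cg by (intro add_mono) auto
  also have "\<dots> = ennreal e"
    using e by (simp add: ennreal_plus[symmetric] del: ennreal_plus)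
  finally show ?thesis using that[OF g(1)] by blast
qed

lemma lp_norm_finite_grand_norm:
  assumes "grand_norm \<psi> f < \<infinity>" "p \<ge> 1" "\<psi> p < \<infinity>"
  shows "lp_norm p f < \<infinity>"
proof -
  have "lp_norm p f / \<psi> p \<le> grand_norm \<psi> f"
    using assms(2) grand_norm_le_iff by blast
  \<comment> \<open>With a finite denominator an infinite norm would give an infinite quotient; the
    finiteness of \<open>\<psi> p\<close> matters because \<open>top / top\<close> is
    \<open>0\<close>.\<close>
  then show ?thesis
    using assms by (cases "lp_norm p f = top") (auto simp: ennreal_top_divide top_unique less_top[symmetric])
qed

text \<open>The vanishing property is closed under approximation: a trigonometric polynomial is
  bounded on the interval and hence has it, and the remainder is small uniformly in
  \<open>p\<close>.\<close>

lemma lp_norm_div_tendsto_0_if_approx: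
  assumes [measurable]: "f \<in> borel_measurable circle_measure"
    and approx: "\<And>e. e > 0 \<Longrightarrow> \<exists>n. \<exists>g\<in>trig_polys n.
      grand_norm (orlicz_psi M) (\<lambda>x. f x - g x) \<le> ennreal e"
  shows "((\<lambda>p. lp_norm p f / orlicz_psi M p) \<longlongrightarrow> 0) at_top"
proof (rule tendsto_zero_ennreal)
  fix r :: real assume r: "r > 0"
  let ?\<psi> = "orlicz_psi M"
  obtain n g where g: "g \<in> trig_polys n" "grand_norm ?\<psi> (\<lambda>x. f x - g x) \<le> ennreal (r / 2)"
    using approx[of "r / 2"] r by auto
  have cont: "continuous_on {0..2 * pi} g" by (rule continuous_on_trig_polys[OF g(1)])
  note [measurable] = borel_measurable_circle_measure_continuous[OF cont]
  have "bounded (g ` {0..2 * pi})"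
    using cont by (intro compact_imp_bounded compact_continuous_image) auto
  then obtain B where "\<forall>x\<in>{0..2 * pi}. \<bar>g x\<bar> \<le> B"
    by (auto simp: bounded_iff)
  then have "((\<lambda>p. lp_norm p g / ?\<psi> p) \<longlongrightarrow> 0) at_top"
    by (intro lp_norm_bounded_div_orlicz_psi[of _ B] AE_I2) (auto simp: space_circle_measure)
  then have "\<forall>\<^sub>F p in at_top. lp_norm p g / ?\<psi> p < ennreal (r / 2)"
    using r by (intro order_tendstoD(2)) auto
  then show "\<forall>\<^sub>F p in at_top. lp_norm p f / ?\<psi> p < ennreal r"
    using eventually_ge_at_top[of "1::real"]
  proof eventually_elim
    case (elim p)
    have "lp_norm p (\<lambda>x. (f x - g x) + g x) \<le> lp_norm p (\<lambda>x. f x - g x) + lp_norm p g"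
      using elim by (intro lp_norm_add) auto
    then have "lp_norm p f / ?\<psi> p \<le> (lp_norm p (\<lambda>x. f x - g x) + lp_norm p g) / ?\<psi> p"
      by (intro divide_right_mono_ennreal) simp
    also have "\<dots> = lp_norm p (\<lambda>x. f x - g x) / ?\<psi> p + lp_norm p g / ?\<psi> p"
      by (rule add_divide_distrib_ennreal)
    \<comment> \<open>The first summand is at most \<open>r / 2\<close> for every \<open>p\<close>;
      only the second is strictly smaller, which suffices.\<close>
    also have "\<dots> < ennreal (r / 2) + ennreal (r / 2)"
      using elim g(2) unfolding grand_norm_le_iff
      by (intro ennreal_add_left_cancel_less[THEN iffD2, THEN le_less_trans[rotated]] 
          add_right_mono) auto
    also have "\<dots> = ennreal r"
      using r by (simp add: ennreal_plus[symmetric] del: ennreal_plus)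
    finally show ?case .
  qed
qed

section \<open>Transfer between the Luxemburg and Grand Lebesgue norms\<close>

theorem theorem4p1:
  fixes M f :: "real \<Rightarrow> real"
  assumes "exponential_young_orlicz M"
    and "orlicz_grand_equivalent M"
    and "f \<in> orlicz_space M"
  shows "((\<lambda>n. best_approx M n f) \<longlonglongrightarrow> 0 \<longleftrightarrow> f \<in> grand_space_o (orlicz_psi M)) \<and>
         (f \<in> grand_space_o (orlicz_psi M) \<longleftrightarrow>
           ((\<lambda>p. lp_norm p f / orlicz_psi M p) \<longlongrightarrow> 0) at_top)"
proof -
  let ?\<psi> = "orlicz_psi M"
  obtain c C :: real where c: "c > 0" "c \<le> C"
    and lower: "\<And>f. f \<in> borel_measurable circle_measure \<Longrightarrow>
      ennreal c * luxemburg_norm M f \<le> grand_norm ?\<psi> f"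
    and upper: "\<And>f. f \<in> borel_measurable circle_measure \<Longrightarrow>
      grand_norm ?\<psi> f \<le> ennreal C * luxemburg_norm M f"
    using assms(2) unfolding orlicz_grand_equivalent_def by blast
  have C: "C > 0" using c by simp
  have f[measurable]: "f \<in> borel_measurable circle_measure" and "luxemburg_norm M f < \<infinity>"
    using assms(3) by (auto simp: orlicz_space_def)
  then have "ennreal C * luxemburg_norm M f < \<infinity>"
    by (simp add: ennreal_mult_less_top)
  then have fin: "grand_norm ?\<psi> f < \<infinity>"
    using upper[OF f] by order
  have diff[measurable]: "(\<lambda>x. f x - g x) \<in> borel_measurable circle_measure"
    if "g \<in> trig_polys n" for g n
    using borel_measurable_circle_measure_continuous[OF continuous_on_trig_polys[OF that]] by simp
  \<comment> \<open>The upper norm comparison already puts \<open>f\<close> into the Grand Lebesgue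
    space, so only the limit condition remains.\<close>
  have grand_o: "f \<in> grand_space_o ?\<psi> \<longleftrightarrow> ((\<lambda>p. lp_norm p f / ?\<psi> p) \<longlongrightarrow> 0) at_top"
    using f fin by (simp add: grand_space_o_def grand_space_def)
  have "(\<lambda>n. best_approx M n f) \<longlonglongrightarrow> 0"
    if lim: "((\<lambda>p. lp_norm p f / ?\<psi> p) \<longlongrightarrow> 0) at_top"
  proof (rule tendsto_zero_ennreal)
    fix r :: real assume r: "r > 0"
    \<comment> \<open>Exponentiality of \<open>M\<close> makes \<open>orlicz_psi\<close> finite, so
      finiteness of the Grand Lebesgue norm passes to each \<open>L_p\<close> norm.\<close>
    have "lp_norm p f < \<infinity>" if "p \<ge> 1" for p
      using assms(1) that fin
      by (intro lp_norm_finite_grand_norm[of ?\<psi>]) (auto simp: exponential_young_orlicz_def)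
    \<comment> \<open>The target \<open>c * (r / 2)\<close> is chosen so that the lower norm
      constant cancels.\<close>
    then obtain n g where g: "g \<in> trig_polys n"
      and "grand_norm ?\<psi> (\<lambda>x. f x - g x) \<le> ennreal (c * (r / 2))"
      using grand_norm_approx_trig_polys[OF f _ lim, of "c * (r / 2)"] c r
      by (metis half_gt_zero mult_pos_pos)
    then have "ennreal c * luxemburg_norm M (\<lambda>x. f x - g x) \<le> ennreal c * ennreal (r / 2)"
      using lower[OF diff[OF g]] c r by (simp add: ennreal_mult[symmetric])
    then have le: "luxemburg_norm M (\<lambda>x. f x - g x) \<le> ennreal (r / 2)"
      using c by (simp add: ennreal_mult_le_mult_iff)
    \<comment> \<open>One good polynomial serves all larger degrees, since the spaces
      \<open>trig_polys\<close> are nested.\<close>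
    show "\<forall>\<^sub>F n in sequentially. best_approx M n f < ennreal r"
      using eventually_ge_at_top[of n]
    proof eventually_elim
      case (elim k)
      have "best_approx M k f \<le> luxemburg_norm M (\<lambda>x. f x - g x)"
        unfolding best_approx_def using trig_polys_mono[OF elim] g by (intro INF_lower) auto
      also have "\<dots> \<le> ennreal (r / 2)" by (rule le)
      also have "\<dots> < ennreal r" using r by (simp add: ennreal_less_iff)
      finally show ?case .
    qed
  qed
  moreover have "((\<lambda>p. lp_norm p f / ?\<psi> p) \<longlongrightarrow> 0) at_top"
    if lim: "(\<lambda>n. best_approx M n f) \<longlonglongrightarrow> 0"
  proof (rule lp_norm_div_tendsto_0_if_approx[OF f])
    fix e :: real assume e: "e > 0"
    \<comment> \<open>The bound \<open>e / C\<close> becomes \<open>e\<close> after applying the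
      upper norm constant.\<close>
    have "\<forall>\<^sub>F n in sequentially. best_approx M n f < ennreal (e / C)"
      using lim e C by (intro order_tendstoD(2)) auto
    then obtain n where "best_approx M n f < ennreal (e / C)"
      using eventually_happens'[OF sequentially_bot] by blast
    then obtain g where g: "g \<in> trig_polys n" "luxemburg_norm M (\<lambda>x. f x - g x) < ennreal (e / C)"
      unfolding best_approx_def INF_less_iff by blast
    have "grand_norm ?\<psi> (\<lambda>x. f x - g x) \<le> ennreal C * luxemburg_norm M (\<lambda>x. f x - g x)"
      by (rule upper[OF diff[OF g(1)]])
    also have "\<dots> \<le> ennreal C * ennreal (e / C)"
      using g(2) by (intro mult_left_mono) auto
    also have "\<dots> = ennreal e"
      using C e by (simp add: ennreal_mult[symmetric])
    finally show "\<exists>n. \<exists>g\<in>trig_polys n. grand_norm ?\<psi> (\<lambda>x. f x - g x) \<le> ennreal e"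
      using g(1) by blast
  qed
  ultimately show ?thesis using grand_o by blast
qed

end
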